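(* Let $\alpha_1,\dots,\alpha_n$ be distinct nonzero elements of $\mathbb{F}_q$, let $w_1,\dots,w_n\in\mathbb{F}_q^*$, let $f(x)\in\mathbb{F}_q[x]$, let $t\ge 2$ be even with $t<n$, and let $C\subseteq\mathbb{F}_q^n$ be the code with parity-check matrix $H$ (a $t\times n$ matrix of rank $t$, defined in the context). Assume $C$ is an MDS $[n,n-t,t+1]$ code. Let $\boldsymbol r\in\mathbb{F}_q^n$ satisfy $d(\boldsymbol r,C)\le\frac t2$, let $(s_0,\dots,s_{t-1})^T=H\boldsymbol r^T$ and let $S(x)=\sum_{i=0}^{t-1}s_{t-1-i}x^i$ be its syndrome polynomial. Then there is a pair of polynomials $(\sigma(x),\tau(x))$ over $\mathbb{F}_q$, with $\sigma\neq 0$, satisfying all of the following, and it is unique up to the leading coefficient of $\sigma(x)$ (i.e., up to multiplying both $\sigma$ and $\tau$ by a common element of $\mathbb{F}_q^*$): (i) $S(x)\sigma(x)\equiv\tau(x)\pmod{x^t}$; (ii) $\gcd(\sigma(x),\tau(x))=1$ and $\deg\tau(x)\le\deg\sigma(x)\le\frac t2$; (iii) putting $J=\{i: 1\le i\le n,\ \sigma(\alpha_i)=0\}$, one has $\deg\sigma(x)=|J|$; (iv) putting $e_i=-\dfrac{\tau(\alpha_i)}{w_i\alpha_i^t\sigma'(\alpha_i)}$ for $i\in J$ and $e_i=0$ for $i\notin J$, one has $$\tau(x)=a\,\sigma(x)+\omega(x),\qquad a=\sum_{j\in J}e_jw_jf(\alpha_j),\qquad \omega(x)=-\sum_{j\in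 J}e_jw_j\alpha_j^t\frac{\sigma(x)}{x-\alpha_j},\qquad \deg \omega(x)<|J|.$$
   Context: $\mathbb{F}_q$ is the finite field with $q$ elements. The matrix $H$ is the $t\times n$ matrix whose rows are $(w_1\alpha_1^i,\dots,w_n\alpha_n^i)$ for $0\le i\le t-2$, followed by the last row $\big(w_1(\alpha_1^{t-1}+f(\alpha_1)),\dots,w_n(\alpha_n^{t-1}+f(\alpha_n))\big)$, and $C=\{\boldsymbol c\in\mathbb{F}_q^n: H\boldsymbol c^T=0\}$. $d(\boldsymbol r,C)$ is the minimum Hamming distance from $\boldsymbol r$ to a codeword of $C$. $\sigma'(x)$ is the formal derivative of $\sigma(x)$. Convention: $\deg 0=-\infty$. *)

theory Defs
  imports "Jordan_Normal_Form.DL_Rank" "HOL-Number_Theory.Cong"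
    "HOL-Computational_Algebra.Polynomial"
begin

(* Positions 1..n of the usual notation are the indices 0..<n here. *)

definition hamming_dist :: "'a vec \<Rightarrow> 'a vec \<Rightarrow> nat" where
  "hamming_dist u v = card {i. i < dim_vec u \<and> u $ i \<noteq> v $ i}"

definition dist_to_code :: "'a vec \<Rightarrow> 'a vec set \<Rightarrow> nat" where
  "dist_to_code r C = (INF c\<in>C. hamming_dist r c)"

(* The infimum over nat is attained for a nonempty set and is 0 for the empty one, so a code with
   at most one word has min_dist 0. *)
definition min_dist :: "'a vec set \<Rightarrow> nat" where
  "min_dist C = Inf {hamming_dist u v | u v. u \<in> C \<and> v \<in> C \<and> u \<noteq> v}"

definition linear_code :: "nat \<Rightarrow> nat \<Rightarrow> nat \<Rightarrow> 'a::field vec set \<Rightarrow> bool" where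
  "linear_code n k d C \<longleftrightarrow>
     VectorSpace.subspace class_ring C (module_vec TYPE('a) n) \<and>
     vectorspace.dim class_ring (module_vec TYPE('a) n\<lparr>carrier := C\<rparr>) = k \<and>
     min_dist C = d"

(* The Singleton bound d <= n - k + 1 holds with equality. *)
definition mds_code :: "nat \<Rightarrow> nat \<Rightarrow> nat \<Rightarrow> 'a::field vec set \<Rightarrow> bool" where
  "mds_code n k d C \<longleftrightarrow> linear_code n k d C \<and> d + k = n + 1"

definition parity_check ::
  "nat \<Rightarrow> nat \<Rightarrow> (nat \<Rightarrow> 'a) \<Rightarrow> (nat \<Rightarrow> 'a) \<Rightarrow> 'a poly \<Rightarrow> 'a::field mat" where
  "parity_check t n \<alpha> w f = mat t n (\<lambda>(i, j).
     if i = t - 1 then w j * (\<alpha> j ^ (t - 1) + poly f (\<alpha> j)) else w j * \<alpha> j ^ i)"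

definition syndrome_poly :: "nat \<Rightarrow> 'a::field mat \<Rightarrow> 'a vec \<Rightarrow> 'a poly" where
  "syndrome_poly t H r = (\<Sum>i<t. monom ((H *\<^sub>v r) $ (t - 1 - i)) i)"

definition root_positions :: "nat \<Rightarrow> (nat \<Rightarrow> 'a) \<Rightarrow> 'a::field poly \<Rightarrow> nat set" where
  "root_positions n \<alpha> \<sigma> = {i. i < n \<and> poly \<sigma> (\<alpha> i) = 0}"

definition error_value ::
  "nat \<Rightarrow> nat \<Rightarrow> (nat \<Rightarrow> 'a) \<Rightarrow> (nat \<Rightarrow> 'a) \<Rightarrow> 'a poly \<Rightarrow> 'a poly \<Rightarrow> nat \<Rightarrow> 'a::field" where
  "error_value t n \<alpha> w \<sigma> \<tau> i =
     (if i \<in> root_positions n \<alpha> \<sigma>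
      then - (poly \<tau> (\<alpha> i) / (w i * \<alpha> i ^ t * poly (pderiv \<sigma>) (\<alpha> i)))
      else 0)"

definition error_evaluator ::
  "nat \<Rightarrow> nat \<Rightarrow> (nat \<Rightarrow> 'a) \<Rightarrow> (nat \<Rightarrow> 'a) \<Rightarrow> 'a poly \<Rightarrow> 'a poly \<Rightarrow> 'a::field poly" where
  "error_evaluator t n \<alpha> w \<sigma> \<tau> =
     - (\<Sum>j\<in>root_positions n \<alpha> \<sigma>.
          Polynomial.smult (error_value t n \<alpha> w \<sigma> \<tau> j * w j * \<alpha> j ^ t) (\<sigma> div [:- \<alpha> j, 1:]))"

(* The mathematical convention is deg 0 = -infinity, whereas the library has degree 0 = 0.
   For deg \<tau> <= deg \<sigma> with \<sigma> nonzero the two agree; for the strict bound on the error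
   evaluator \<omega> the case \<omega> = 0 has to be allowed separately. *)
definition key_equation_pair ::
  "nat \<Rightarrow> nat \<Rightarrow> (nat \<Rightarrow> 'a) \<Rightarrow> (nat \<Rightarrow> 'a) \<Rightarrow> 'a poly \<Rightarrow> 'a poly \<Rightarrow>
   'a poly \<Rightarrow> 'a::field poly \<Rightarrow> bool" where
  "key_equation_pair t n \<alpha> w f S \<sigma> \<tau> \<longleftrightarrow>
     (let J = root_positions n \<alpha> \<sigma>;
          e = error_value t n \<alpha> w \<sigma> \<tau>;
          a = (\<Sum>j\<in>J. e j * w j * poly f (\<alpha> j));
          \<omega> = error_evaluator t n \<alpha> w \<sigma> \<tau>
      in \<sigma> \<noteq> 0 \<and>
         [S * \<sigma> = \<tau>] (mod (monom 1 t)) \<and>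
         coprime \<sigma> \<tau> \<and> degree \<tau> \<le> degree \<sigma> \<and> degree \<sigma> \<le> t div 2 \<and>
         degree \<sigma> = card J \<and>
         \<tau> = Polynomial.smult a \<sigma> + \<omega> \<and> (\<omega> = 0 \<or> degree \<omega> < card J))"

end

theory Submission
  imports Defs
begin

text \<open>
  The valid pairs correspond to the error vectors \<open>e\<close> of weight at most \<open>t/2\<close> with the same
  syndrome as \<open>r\<close>: since \<open>\<Sum>i<t. \<alpha>\<^sup>t\<^sup>-\<^sup>1\<^sup>-\<^sup>i x\<^sup>i = (x\<^sup>t - \<alpha>\<^sup>t) / (x - \<alpha>)\<close>, multiplying the syndrome polynomial
  of \<open>e\<close> by a polynomial \<open>\<sigma>\<close> vanishing at the error locators leaves \<open>a \<sigma> + \<omega>\<close> modulo \<open>x\<^sup>t\<close>.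
  Conversely \<open>\<sigma>(0) \<noteq> 0\<close>, so \<open>\<sigma>\<close> can be cancelled modulo \<open>x\<^sup>t\<close>, and a valid pair determines the
  syndrome. By the minimum distance \<open>t + 1\<close> there is only one such \<open>e\<close>, and a polynomial with
  as many roots as its degree is determined by them up to a constant.
\<close>

section \<open>Distances in codes\<close>

lemma min_dist_le:
  assumes "u \<in> C" "v \<in> C" "u \<noteq> v"
  shows "min_dist C \<le> hamming_dist u v"
  unfolding min_dist_def by (rule wellorder_Inf_le1) (use assms in blast)

lemma dist_to_code_attained:
  assumes "C \<noteq> {}"
  obtains c where "c \<in> C" "hamming_dist r c = dist_to_code r C"
proof -
  have "Inf (hamming_dist r ` C) \<in> hamming_dist r ` C"
    using assms by (intro Inf_nat_def1) auto
  then show ?thesis using that unfolding dist_to_code_def by force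
qed

section \<open>Polynomials vanishing at distinct points\<close>

lemma card_le_degree_if_roots:
  fixes p :: "'a::field poly"
  assumes "p \<noteq> 0" "inj_on \<alpha> J" "\<And>j. j \<in> J \<Longrightarrow> poly p (\<alpha> j) = 0"
  shows "card J \<le> degree p"
proof -
  have "card J = card (\<alpha> ` J)" using assms(2) by (simp add: card_image)
  also have "\<dots> \<le> card {x. poly p x = 0}"
    using assms by (intro card_mono poly_roots_finite) auto
  also have "\<dots> \<le> degree p" using assms(1) by (rule card_poly_roots_bound)
  finally show ?thesis .
qed

text \<open>After \<open>q\<close> is scaled to the leading coefficient of \<open>p\<close>, the
  difference has degree below \<open>card J\<close> or is zero, yet it vanishes at
  \<open>card J\<close> points.\<close>

lemma eq_smult_if_common_roots:
  fixes p q :: "'a::field poly"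
  assumes "p \<noteq> 0" "q \<noteq> 0" "degree p = card J" "degree q = card J" "inj_on \<alpha> J"
    and "\<And>j. j \<in> J \<Longrightarrow> poly p (\<alpha> j) = 0" "\<And>j. j \<in> J \<Longrightarrow> poly q (\<alpha> j) = 0"
  obtains c where "c \<noteq> 0" "p = Polynomial.smult c q"
proof
  let ?c = "lead_coeff p / lead_coeff q"
  have "lead_coeff p \<noteq> 0" "lead_coeff q \<noteq> 0" using assms(1,2) by simp_all
  then show "?c \<noteq> 0" by simp
  show "p = Polynomial.smult ?c q"
  proof (rule poly_eqI_degree_lead_coeff)
    show "coeff p (card J) = coeff (Polynomial.smult ?c q) (card J)"
      using \<open>lead_coeff q \<noteq> 0\<close> by (simp add: assms(3,4))
    show "card J \<le> card (\<alpha> ` J)" using assms(5) by (simp add: card_image)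
  qed (use assms in auto)
qed

text \<open>A divisor \<open>d\<close> of \<open>q\<close> is nonzero at every
  \<open>\<alpha> j\<close>, so when \<open>p = d * k\<close> all the roots fall to
  \<open>k\<close>. They use up the whole degree of \<open>p\<close> and leave \<open>d\<close>
  constant.\<close>

lemma coprime_if_no_common_root:
  fixes p q :: "'a::field poly"
  assumes "p \<noteq> 0" "degree p = card J" "inj_on \<alpha> J"
    and root: "\<And>j. j \<in> J \<Longrightarrow> poly p (\<alpha> j) = 0"
    and nroot: "\<And>j. j \<in> J \<Longrightarrow> poly q (\<alpha> j) \<noteq> 0"
  shows "coprime p q"
proof (rule coprimeI)
  fix d assume d: "d dvd p" "d dvd q"
  then obtain k where k: "p = d * k" by (elim dvdE)
  have "poly k (\<alpha> j) = 0" if "j \<in> J" for j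
    using root[OF that] nroot[OF that] d(2) by (auto simp: k elim!: dvdE)
  then have "card J \<le> degree k"
    using assms k by (intro card_le_degree_if_roots) auto
  then have "degree d = 0"
    using assms k by (auto simp: degree_mult_eq)
  then show "is_unit d" using assms(1) k by (auto simp: is_unit_iff_degree)
qed

lemma linear_mult_div:
  fixes p :: "'a::field poly"
  assumes "poly p a = 0"
  shows "[:- a, 1:] * (p div [:- a, 1:]) = p"
  using assms unfolding poly_eq_0_iff_dvd by (rule dvd_mult_div_cancel)

lemma degree_div_linear_less:
  fixes p :: "'a::field poly"
  assumes "p \<noteq> 0" "poly p a = 0"
  shows "degree (p div [:- a, 1:]) < degree p"
proof -
  let ?g = "p div [:- a, 1:]"
  have p: "[:- a, 1:] * ?g = p" using assms(2) by (rule linear_mult_div)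
  then have "?g \<noteq> 0" using assms(1) by auto
  then have "degree ([:- a, 1:] * ?g) = Suc (degree ?g)"
    by (subst degree_mult_eq) auto
  then show ?thesis unfolding p by simp
qed

text \<open>By the product rule the derivative is the quotient plus a multiple of x - a, and the
  latter vanishes at a.\<close>

lemma poly_div_linear_self:
  fixes p :: "'a::field poly"
  assumes "poly p a = 0"
  shows "poly (p div [:- a, 1:]) a = poly (pderiv p) a"
proof -
  have "p = [:- a, 1:] * (p div [:- a, 1:])" using assms by (simp only: linear_mult_div)
  then have "pderiv p = pderiv ([:- a, 1:] * (p div [:- a, 1:]))" by simp
  also have "poly \<dots> a = poly (p div [:- a, 1:]) a"
    by (simp add: pderiv_mult pderiv_pCons del: mult_pCons_left)
  finally show ?thesis by simp
qed

lemma poly_div_linear_other: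
  fixes p :: "'a::field poly"
  assumes "poly p a = 0" "poly p b = 0" "a \<noteq> b"
  shows "poly (p div [:- a, 1:]) b = 0"
proof -
  have "p = [:- a, 1:] * (p div [:- a, 1:])" using assms by (simp only: linear_mult_div)
  then have "poly p b = poly ([:- a, 1:] * (p div [:- a, 1:])) b" by simp
  then show ?thesis using assms by simp
qed

text \<open>The roots are simple: if the derivative vanished at \<open>\<alpha> i\<close>, the
  quotient by the linear factor would still vanish on all of \<open>J\<close>, with degree below
  \<open>card J\<close>.\<close>

lemma pderiv_root_nonzero:
  fixes p :: "'a::field poly"
  assumes "p \<noteq> 0" "degree p = card J" "inj_on \<alpha> J" "i \<in> J"
    and root: "\<And>j. j \<in> J \<Longrightarrow> poly p (\<alpha> j) = 0"
  shows "poly (pderiv p) (\<alpha> i) \<noteq> 0"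
proof
  let ?g = "p div [:- \<alpha> i, 1:]"
  assume "poly (pderiv p) (\<alpha> i) = 0"
  then have "poly ?g (\<alpha> j) = 0" if "j \<in> J" for j
    using poly_div_linear_self[of p "\<alpha> i"] poly_div_linear_other[of p "\<alpha> i" "\<alpha> j"]
      root that assms by (cases "j = i") (auto dest: inj_onD)
  moreover have "[:- \<alpha> i, 1:] * ?g = p"
    using root[OF assms(4)] by (rule linear_mult_div)
  then have "?g \<noteq> 0" using assms(1) by auto
  ultimately have "card J \<le> degree ?g"
    using assms by (intro card_le_degree_if_roots) auto
  moreover have "degree ?g < degree p"
    using assms(1) root[OF assms(4)] by (rule degree_div_linear_less)
  ultimately show False using assms by simp
qed

text \<open>As \<open>s\<close> is nonzero at 0, it contributes nothing to the order at 0, so x^t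
  already divides \<open>p - q\<close>. This settles the coefficients below \<open>t\<close>; the
  last hypothesis settles the others.\<close>

lemma cong_monom_cancel:
  fixes p q s :: "'a::field poly"
  assumes "[p * s = q * s] (mod monom 1 t)" "poly s 0 \<noteq> 0"
    and "\<And>i. i \<ge> t \<Longrightarrow> coeff p i = coeff q i"
  shows "p = q"
proof (rule ccontr)
  assume "p \<noteq> q"
  have d: "monom 1 t dvd (p - q) * s"
    using assms(1) by (simp add: cong_iff_dvd_diff algebra_simps)
  have s: "s \<noteq> 0" using assms(2) by auto
  then have nz: "(p - q) * s \<noteq> 0" using \<open>p \<noteq> q\<close> by simp
  then have "t \<le> order 0 ((p - q) * s)" using d by (simp add: monom_1_dvd_iff)
  also have "\<dots> = order 0 (p - q)"
    using nz assms(2) s by (simp add: order_mult order_root)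
  finally have "monom 1 t dvd p - q" using \<open>p \<noteq> q\<close> by (simp add: monom_1_dvd_iff)
  then have "coeff (p - q) i = 0" if "i < t" for i
    using that by (simp add: monom_1_dvd_iff')
  with assms(3) have "coeff p i = coeff q i" for i
    by (cases "i < t") auto
  with \<open>p \<noteq> q\<close> show False by (simp add: poly_eq_iff)
qed

section \<open>Error locators and evaluators\<close>

definition support :: "nat \<Rightarrow> (nat \<Rightarrow> 'a::zero) \<Rightarrow> nat set" where
  "support n e = {i. i < n \<and> e i \<noteq> 0}"

lemma finite_support [simp]: "finite (support n e)"
  unfolding support_def by simp

text \<open>The error locator polynomial, with roots at the locators themselves rather than at their
  inverses. It is not normalised to be monic, which matches uniqueness up to a constant; the degree
  condition excludes further and repeated roots.\<close>

definition locates :: "nat \<Rightarrow> (nat \<Rightarrow> 'a) \<Rightarrow> (nat \<Rightarrow> 'a) \<Rightarrow> 'a::field poly \<Rightarrow> bool" where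
  "locates n \<alpha> e \<sigma> \<longleftrightarrow>
     \<sigma> \<noteq> 0 \<and> degree \<sigma> = card (support n e) \<and> (\<forall>j\<in>support n e. poly \<sigma> (\<alpha> j) = 0)"

text \<open>Counterpart of \<open>error_evaluator\<close> with the error values given in advance
  instead of being computed from \<sigma> and \<tau>.\<close>

definition evaluator ::
  "nat \<Rightarrow> nat \<Rightarrow> (nat \<Rightarrow> 'a) \<Rightarrow> (nat \<Rightarrow> 'a) \<Rightarrow> (nat \<Rightarrow> 'a) \<Rightarrow> 'a poly \<Rightarrow> 'a::field poly" where
  "evaluator t n \<alpha> w e \<sigma> =
     - (\<Sum>j\<in>support n e. Polynomial.smult (e j * w j * \<alpha> j ^ t) (\<sigma> div [:- \<alpha> j, 1:]))"

text \<open>The only \<tau> that condition (iv) permits once the error values and \<sigma> are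
  known.\<close>

definition numerator ::
  "nat \<Rightarrow> nat \<Rightarrow> (nat \<Rightarrow> 'a) \<Rightarrow> (nat \<Rightarrow> 'a) \<Rightarrow> 'a poly \<Rightarrow> (nat \<Rightarrow> 'a) \<Rightarrow> 'a poly \<Rightarrow>
   'a::field poly" where
  "numerator t n \<alpha> w f e \<sigma> =
     Polynomial.smult (\<Sum>j\<in>support n e. e j * w j * poly f (\<alpha> j)) \<sigma> + evaluator t n \<alpha> w e \<sigma>"

lemma locates_exists:
  obtains \<sigma> where "locates n \<alpha> e \<sigma>"
proof
  let ?s = "\<Prod>j\<in>support n e. [:- \<alpha> j, 1:]"
  have "degree ?s = card (support n e)"
    by (subst degree_prod_eq_sum_degree) auto
  then show "locates n \<alpha> e ?s"
    unfolding locates_def by (auto simp: poly_prod)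
qed

lemma numerator_smult:
  fixes \<sigma> :: "'a::field poly"
  shows
  "numerator t n \<alpha> w f e (Polynomial.smult c \<sigma>) = Polynomial.smult c (numerator t n \<alpha> w f e \<sigma>)"
proof -
  \<comment> \<open>Scaling by \<open>c\<close> is multiplication by the constant polynomial
    \<open>[:c:]\<close>, so ordinary distributivity applies.\<close>
  have "Polynomial.smult c (\<Sum>j\<in>support n e. g j) = (\<Sum>j\<in>support n e. Polynomial.smult c (g j))"
    for g :: "nat \<Rightarrow> 'a poly"
    using sum_distrib_left[of "[:c:]" g] by simp
  then show ?thesis
    unfolding numerator_def evaluator_def
    by (simp add: smult_add_right smult_diff_right div_smult_left mult_ac)
qed

lemma locates_smult:
  "locates n \<alpha> e \<sigma> \<Longrightarrow> c \<noteq> 0 \<Longrightarrow> locates n \<alpha> e (Polynomial.smult c \<sigma>)"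
  unfolding locates_def by simp

section \<open>Syndromes and the key equation\<close>

lemma syndrome_parity_check:
  fixes \<alpha> w :: "nat \<Rightarrow> 'a::field"
  assumes "k < t"
  shows "(parity_check t n \<alpha> w f *\<^sub>v vec n e) $ k =
    (\<Sum>j\<in>support n e. e j * w j * (\<alpha> j ^ k + (if k = t - 1 then poly f (\<alpha> j) else 0)))"
proof -
  have "(parity_check t n \<alpha> w f *\<^sub>v vec n e) $ k =
    (\<Sum>j\<in>{..<n}. e j * w j * (\<alpha> j ^ k + (if k = t - 1 then poly f (\<alpha> j) else 0)))"
    using assms by (auto simp: parity_check_def scalar_prod_def mult.commute atLeast0LessThan
        intro!: sum.cong)
  also have "\<dots> = (\<Sum>j\<in>support n e. e j * w j * (\<alpha> j ^ k + (if k = t - 1 then poly f (\<alpha> j) else 0)))"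
    by (rule sum.mono_neutral_right) (auto simp: support_def)
  finally show ?thesis .
qed

text \<open>The syndrome polynomial lists the rows in reverse, so the exceptional last row lands in
  the constant coefficient. Hence all contributions of \<open>f\<close> collect in one constant, and
  the rest is a geometric sum for each error.\<close>

lemma syndrome_poly_parity_check:
  fixes \<alpha> w :: "nat \<Rightarrow> 'a::field"
  assumes "t > 0"
  shows "syndrome_poly t (parity_check t n \<alpha> w f) (vec n e) =
    [:\<Sum>j\<in>support n e. e j * w j * poly f (\<alpha> j):] +
    (\<Sum>j\<in>support n e. Polynomial.smult (e j * w j) (\<Sum>i<t. monom (\<alpha> j ^ (t - 1 - i)) i))"
    (is "?l = ?r")
proof (rule poly_eqI)
  fix i
  let ?J = "support n e"
  show "coeff ?l i = coeff ?r i"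
  proof (cases "i < t")
    case True
    \<comment> \<open>Row \<open>t - 1 - i\<close> is the last one exactly for \<open>i = 0\<close>;
      truncated subtraction makes this depend on \<open>i < t\<close>.\<close>
    have last: "t - Suc i = t - Suc 0 \<longleftrightarrow> i = 0" using True by auto
    have "coeff ?l i =
        (\<Sum>j\<in>?J. e j * w j * (\<alpha> j ^ (t - 1 - i) + (if i = 0 then poly f (\<alpha> j) else 0)))"
      using True by (simp add: syndrome_poly_def coeff_sum syndrome_parity_check last)
    also have "\<dots> = (\<Sum>j\<in>?J. e j * w j * (if i = 0 then poly f (\<alpha> j) else 0)) +
        (\<Sum>j\<in>?J. e j * w j * \<alpha> j ^ (t - 1 - i))"
      by (simp add: sum.distrib ring_distribs)
    also have "\<dots> = coeff ?r i"
      using True by (simp add: coeff_sum coeff_pCons split: nat.split)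
    finally show ?thesis .
  next
    case False
    then show ?thesis using assms
      by (cases i) (auto simp: syndrome_poly_def coeff_sum intro!: sum.neutral)
  qed
qed

lemma linear_mult_geometric:
  fixes a :: "'a::field"
  assumes "t > 0"
  shows "[:- a, 1:] * (\<Sum>i<t. monom (a ^ (t - 1 - i)) i) = monom 1 t - [:a ^ t:]"
proof -
  obtain m where t: "t = Suc m" using assms by (cases t) auto
  have x: "monom 1 1 - [:a:] = [:- a, 1:]" by (simp add: monom_altdef)
  have "monom 1 1 ^ Suc m - [:a:] ^ Suc m
      = (monom 1 1 - [:a:]) * (\<Sum>i<Suc m. monom 1 1 ^ i * [:a:] ^ (m - i))"
    by (rule diff_power_eq_sum)
  also have "(\<Sum>i<Suc m. monom 1 1 ^ i * [:a:] ^ (m - i)) = (\<Sum>i<t. monom (a ^ (t - 1 - i)) i)"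
    unfolding t by (intro sum.cong) (auto simp: monom_power poly_const_pow smult_monom)
  finally show ?thesis
    unfolding x by (simp only: monom_power poly_const_pow t power_one mult_1)
qed

text \<open>The constant from \<open>f\<close> yields the multiple of \<sigma>. Each error yields
  (x^t - \<alpha>^t) times the quotient of \<sigma> by its linear factor: the x^t part disappears
  modulo x^t and the remainder is a summand of the evaluator.\<close>

lemma syndrome_key_equation:
  fixes \<alpha> w :: "nat \<Rightarrow> 'a::field"
  assumes "t > 0" and root: "\<And>j. j \<in> support n e \<Longrightarrow> poly \<sigma> (\<alpha> j) = 0"
  shows "[syndrome_poly t (parity_check t n \<alpha> w f) (vec n e) * \<sigma> = numerator t n \<alpha> w f e \<sigma>]
    (mod monom 1 t)"
proof -
  let ?J = "support n e"
  let ?g = "\<lambda>j. \<sigma> div [:- \<alpha> j, 1:]"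
  let ?q = "\<lambda>j. \<Sum>i<t. monom (\<alpha> j ^ (t - 1 - i)) i"
  have g: "?q j * \<sigma> = monom 1 t * ?g j - Polynomial.smult (\<alpha> j ^ t) (?g j)" if "j \<in> ?J" for j
  proof -
    have "?q j * \<sigma> = ?q j * ([:- \<alpha> j, 1:] * ?g j)"
      using root[OF that] by (simp only: linear_mult_div)
    also have "\<dots> = ([:- \<alpha> j, 1:] * ?q j) * ?g j" by (simp only: mult_ac)
    also have "\<dots> = monom 1 t * ?g j - [:\<alpha> j ^ t:] * ?g j"
      by (simp only: linear_mult_geometric[OF assms(1)] left_diff_distrib)
    also have "[:\<alpha> j ^ t:] * ?g j = Polynomial.smult (\<alpha> j ^ t) (?g j)" by simp
    finally show ?thesis .
  qed
  have "syndrome_poly t (parity_check t n \<alpha> w f) (vec n e) * \<sigma> =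
      Polynomial.smult (\<Sum>j\<in>?J. e j * w j * poly f (\<alpha> j)) \<sigma> +
      (\<Sum>j\<in>?J. Polynomial.smult (e j * w j) (?q j * \<sigma>))"
    unfolding syndrome_poly_parity_check[OF assms(1)]
    by (simp add: distrib_right sum_distrib_right)
  also have "(\<Sum>j\<in>?J. Polynomial.smult (e j * w j) (?q j * \<sigma>)) =
      (\<Sum>j\<in>?J. monom 1 t * Polynomial.smult (e j * w j) (?g j)
              - Polynomial.smult (e j * w j * \<alpha> j ^ t) (?g j))"
    by (intro sum.cong refl) (simp only: g smult_diff_right smult_smult mult_smult_right)
  also have "\<dots> = monom 1 t * (\<Sum>j\<in>?J. Polynomial.smult (e j * w j) (?g j)) + evaluator t n \<alpha> w e \<sigma>"
    by (simp add: evaluator_def sum_subtractf sum_distrib_left)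
  finally show ?thesis
    by (simp add: numerator_def cong_iff_dvd_diff)
qed

section \<open>Forney's formula and the pair of an error\<close>

text \<open>At a root the multiple of \<sigma> vanishes, and so does every summand of the evaluator
  but the \<open>i\<close>-th. Solved for \<open>e i\<close>, this is Forney's formula, the
  expression in \<open>error_value\<close>.\<close>

lemma poly_numerator_root:
  fixes \<alpha> w :: "nat \<Rightarrow> 'a::field"
  assumes "inj_on \<alpha> {..<n}" "i \<in> support n e"
    and root: "\<And>j. j \<in> support n e \<Longrightarrow> poly \<sigma> (\<alpha> j) = 0"
  shows "poly (numerator t n \<alpha> w f e \<sigma>) (\<alpha> i) = - (e i * w i * \<alpha> i ^ t * poly (pderiv \<sigma>) (\<alpha> i))"
proof -
  let ?t = "\<lambda>j. e j * w j * \<alpha> j ^ t * poly (\<sigma> div [:- \<alpha> j, 1:]) (\<alpha> i)"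
  have "poly (\<sigma> div [:- \<alpha> j, 1:]) (\<alpha> i) = 0" if "j \<in> support n e" "j \<noteq> i" for j
    using that assms by (intro poly_div_linear_other) (auto simp: support_def dest: inj_onD)
  then have "(\<Sum>j\<in>support n e. ?t j) = (\<Sum>j\<in>{i}. ?t j)"
    using assms(2) by (intro sum.mono_neutral_right) auto
  then show ?thesis
    using root[OF assms(2)]
    by (simp add: numerator_def evaluator_def poly_sum poly_div_linear_self)
qed

text \<open>The error positions already account for the whole degree, so no further
  \<open>\<alpha> i\<close> can be a root.\<close>

lemma root_positions_locates:
  assumes "inj_on \<alpha> {..<n}" "locates n \<alpha> e \<sigma>"
  shows "root_positions n \<alpha> \<sigma> = support n e"
proof -
  have inj: "inj_on \<alpha> (root_positions n \<alpha> \<sigma>)"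
    using assms(1) by (rule inj_on_subset) (auto simp: root_positions_def)
  have "card (root_positions n \<alpha> \<sigma>) \<le> card (support n e)"
    using assms(2) card_le_degree_if_roots[OF _ inj, of \<sigma>]
    by (auto simp: locates_def root_positions_def)
  moreover have "support n e \<subseteq> root_positions n \<alpha> \<sigma>"
    using assms(2) by (auto simp: locates_def support_def root_positions_def)
  moreover have "finite (root_positions n \<alpha> \<sigma>)" by (simp add: root_positions_def)
  ultimately show ?thesis by (metis card_seteq)
qed

lemma degree_evaluator:
  assumes "locates n \<alpha> e \<sigma>"
  shows "evaluator t n \<alpha> w e \<sigma> = 0 \<or> degree (evaluator t n \<alpha> w e \<sigma>) < card (support n e)"
proof (cases "support n e = {}")
  \<comment> \<open>Without errors the strict degree bound would read 0 < 0, so the evaluator has to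
    be zero here.\<close>
  case True
  then show ?thesis by (simp add: evaluator_def)
next
  case False
  then have c: "card (support n e) > 0" by (simp add: card_gt_0_iff)
  have "degree (\<sigma> div [:- \<alpha> j, 1:]) < card (support n e)" if "j \<in> support n e" for j
    using assms that degree_div_linear_less[of \<sigma> "\<alpha> j"] by (auto simp: locates_def)
  then have "degree (evaluator t n \<alpha> w e \<sigma>) < card (support n e)"
    unfolding evaluator_def degree_minus using c
    by (intro degree_sum_less) (auto intro: le_less_trans[OF degree_smult_le])
  then show ?thesis ..
qed

text \<open>Existence half: by Forney's formula the pair returns the error values it was built from,
  so the quantities in (iv) agree with those of \<open>e\<close>. The same formula shows that \<tau>
  is nonzero at every root of \<sigma>, whence coprimality.\<close>

lemma key_equation_pair_of_error:
  fixes \<alpha> w :: "nat \<Rightarrow> 'a::field"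
  assumes inj: "inj_on \<alpha> {..<n}"
    and nz: "\<And>i. i < n \<Longrightarrow> \<alpha> i \<noteq> 0" "\<And>i. i < n \<Longrightarrow> w i \<noteq> 0"
    and "t > 0" and loc: "locates n \<alpha> e \<sigma>" and wt: "card (support n e) \<le> t div 2"
  shows "key_equation_pair t n \<alpha> w f (syndrome_poly t (parity_check t n \<alpha> w f) (vec n e))
    \<sigma> (numerator t n \<alpha> w f e \<sigma>)"
proof -
  let ?J = "support n e"
  let ?\<tau> = "numerator t n \<alpha> w f e \<sigma>"
  have \<sigma>: "\<sigma> \<noteq> 0" "degree \<sigma> = card ?J" "\<And>j. j \<in> ?J \<Longrightarrow> poly \<sigma> (\<alpha> j) = 0"
    using loc by (auto simp: locates_def)
  have J: "root_positions n \<alpha> \<sigma> = ?J" using inj loc by (rule root_positions_locates)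
  have injJ: "inj_on \<alpha> ?J" using inj by (rule inj_on_subset) (auto simp: support_def)
  have d: "poly (pderiv \<sigma>) (\<alpha> j) \<noteq> 0" if "j \<in> ?J" for j
    using \<sigma> injJ that by (intro pderiv_root_nonzero)
  have v: "poly ?\<tau> (\<alpha> j) = - (e j * w j * \<alpha> j ^ t * poly (pderiv \<sigma>) (\<alpha> j))" if "j \<in> ?J" for j
    using inj that \<sigma>(3) by (rule poly_numerator_root)
  have e: "error_value t n \<alpha> w \<sigma> ?\<tau> j = e j" if "j \<in> ?J" for j
    using that d[OF that] nz by (auto simp: error_value_def J v support_def)
  have \<omega>: "error_evaluator t n \<alpha> w \<sigma> ?\<tau> = evaluator t n \<alpha> w e \<sigma>"
    by (simp add: error_evaluator_def evaluator_def J e)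
  have a: "(\<Sum>j\<in>?J. error_value t n \<alpha> w \<sigma> ?\<tau> j * w j * poly f (\<alpha> j)) =
      (\<Sum>j\<in>?J. e j * w j * poly f (\<alpha> j))"
    by (simp add: e)
  have deg: "evaluator t n \<alpha> w e \<sigma> = 0 \<or> degree (evaluator t n \<alpha> w e \<sigma>) < card ?J"
    using loc by (rule degree_evaluator)
  have "degree ?\<tau> \<le> degree \<sigma>"
    unfolding numerator_def using deg \<sigma>(2) by (intro degree_add_le) auto
  moreover have "coprime \<sigma> ?\<tau>"
    using \<sigma>(1,2) injJ \<sigma>(3)
    by (rule coprime_if_no_common_root) (use v d nz in \<open>auto simp: support_def\<close>)
  ultimately show ?thesis
    unfolding key_equation_pair_def Let_def J \<omega> a
    using \<sigma> deg wt syndrome_key_equation[of t n e \<sigma> \<alpha> w f] \<open>t > 0\<close>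
    by (simp add: numerator_def)
qed

section \<open>Recovering the error from a pair\<close>

text \<open>The error is read off by the formula of (iv). Coprimality makes its values nonzero on
  all of \<open>J\<close>, so its support is exactly \<open>J\<close> and \<sigma> locates it. Both
  syndrome polynomials then satisfy the same congruence, from which \<sigma> is cancelled.\<close>

lemma error_of_key_equation_pair:
  fixes \<alpha> w :: "nat \<Rightarrow> 'a::field"
  assumes inj: "inj_on \<alpha> {..<n}"
    and nz: "\<And>i. i < n \<Longrightarrow> \<alpha> i \<noteq> 0" "\<And>i. i < n \<Longrightarrow> w i \<noteq> 0"
    and "t > 0" and pair: "key_equation_pair t n \<alpha> w f (syndrome_poly t H r) \<sigma> \<tau>"
  obtains e where "locates n \<alpha> e \<sigma>" "card (support n e) \<le> t div 2"
    "\<tau> = numerator t n \<alpha> w f e \<sigma>"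
    "syndrome_poly t (parity_check t n \<alpha> w f) (vec n e) = syndrome_poly t H r"
proof -
  define J where "J = root_positions n \<alpha> \<sigma>"
  define e where "e = error_value t n \<alpha> w \<sigma> \<tau>"
  have \<sigma>: "\<sigma> \<noteq> 0" "degree \<sigma> = card J" "degree \<sigma> \<le> t div 2"
    and cop: "coprime \<sigma> \<tau>" and key: "[syndrome_poly t H r * \<sigma> = \<tau>] (mod monom 1 t)"
    and \<tau>: "\<tau> = Polynomial.smult (\<Sum>j\<in>J. e j * w j * poly f (\<alpha> j)) \<sigma> +
      error_evaluator t n \<alpha> w \<sigma> \<tau>"
    using pair unfolding key_equation_pair_def Let_def J_def e_def by blast+
  have root: "poly \<sigma> (\<alpha> j) = 0" "j < n" if "j \<in> J" for j
    using that by (auto simp: J_def root_positions_def)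
  have injJ: "inj_on \<alpha> J" using inj by (rule inj_on_subset) (use root in auto)
  have "e j \<noteq> 0" if "j \<in> J" for j
  proof -
    have "poly (pderiv \<sigma>) (\<alpha> j) \<noteq> 0"
      using \<sigma>(1,2) injJ that root by (intro pderiv_root_nonzero)
    moreover have "poly \<tau> (\<alpha> j) \<noteq> 0"
    proof
      assume "poly \<tau> (\<alpha> j) = 0"
      then have "is_unit [:- \<alpha> j, 1:]"
        using root(1)[OF that] by (intro coprime_common_divisor[OF cop]) (simp_all add: poly_eq_0_iff_dvd)
      then show False by (simp add: is_unit_pCons_iff)
    qed
    ultimately show ?thesis
      using that nz root(2)[OF that] by (simp add: e_def error_value_def J_def)
  qed
  then have supp: "support n e = J"
    using root(2) by (auto simp: support_def e_def error_value_def J_def split: if_splits)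
  have \<tau>e: "\<tau> = numerator t n \<alpha> w f e \<sigma>"
    unfolding numerator_def evaluator_def supp
    by (rule \<tau>[unfolded error_evaluator_def, folded J_def e_def])
  \<comment> \<open>The locators are nonzero, so 0 would be one root more than the degree
    allows.\<close>
  have "poly \<sigma> 0 \<noteq> 0"
  proof
    assume "poly \<sigma> 0 = 0"
    then have "card (insert 0 (\<alpha> ` J)) \<le> degree \<sigma>"
      using \<sigma>(1) root(1) by (intro card_le_degree_if_roots[of \<sigma> "\<lambda>x. x"]) auto
    moreover have "finite J" by (simp add: J_def root_positions_def)
    moreover have "0 \<notin> \<alpha> ` J" using nz(1) root(2) by force
    ultimately show False using \<sigma>(2) injJ by (simp add: card_image)
  qed
  moreover have "[syndrome_poly t (parity_check t n \<alpha> w f) (vec n e) * \<sigma>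
      = syndrome_poly t H r * \<sigma>] (mod monom 1 t)"
  proof (rule cong_trans[OF syndrome_key_equation])
    show "[numerator t n \<alpha> w f e \<sigma> = syndrome_poly t H r * \<sigma>] (mod monom 1 t)"
      using cong_sym[OF key] by (simp only: \<tau>e[symmetric])
  qed (use \<open>t > 0\<close> root(1) supp in auto)
  \<comment> \<open>Syndrome polynomials have no coefficients from \<open>t\<close> on, so the
    congruence modulo x^t becomes an equality.\<close>
  ultimately have "syndrome_poly t (parity_check t n \<alpha> w f) (vec n e) = syndrome_poly t H r"
    by (intro cong_monom_cancel[of _ \<sigma>]) (auto simp: syndrome_poly_def coeff_sum)
  moreover have "locates n \<alpha> e \<sigma>" "card (support n e) \<le> t div 2"
    using \<sigma> root(1) by (simp_all add: locates_def supp)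
  ultimately show ?thesis using \<tau>e by (intro that)
qed

section \<open>Syndromes determine errors of small weight\<close>

lemma syndrome_poly_eq_iff:
  assumes "dim_row H = t"
  shows "syndrome_poly t H u = syndrome_poly t H v \<longleftrightarrow> H *\<^sub>v u = H *\<^sub>v v"
proof
  assume eq: "syndrome_poly t H u = syndrome_poly t H v"
  show "H *\<^sub>v u = H *\<^sub>v v"
  proof (rule eq_vecI)
    fix i assume "i < dim_vec (H *\<^sub>v v)"
    then have i: "i < t" using assms by simp
    have c: "coeff (syndrome_poly t H x) (t - 1 - i) = (H *\<^sub>v x) $ i" for x
      using i by (simp add: syndrome_poly_def coeff_sum)
    show "(H *\<^sub>v u) $ i = (H *\<^sub>v v) $ i"
      using c[of u] c[of v] eq by simp
  qed simp
qed (simp add: syndrome_poly_def)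

text \<open>The difference of the two vectors is a codeword of weight at most \<open>t\<close>,
  below the minimum distance, hence zero.\<close>

lemma vec_eq_if_same_syndrome:
  fixes H :: "'a::field mat"
  assumes H: "H \<in> carrier_mat t n" and C: "C = {c \<in> carrier_vec n. H *\<^sub>v c = 0\<^sub>v t}"
    and min: "t < min_dist C"
    and eq: "H *\<^sub>v vec n e = H *\<^sub>v vec n e'"
    and wt: "card (support n e) + card (support n e') \<le> t"
  shows "vec n e = vec n e'"
proof (rule ccontr)
  let ?c = "vec n e - vec n e'"
  assume "vec n e \<noteq> vec n e'"
  then have ne: "?c \<noteq> 0\<^sub>v n"
    by (auto simp: vec_eq_iff)
  have "H *\<^sub>v ?c = H *\<^sub>v vec n e - H *\<^sub>v vec n e'"
    using H by (intro mult_minus_distrib_mat_vec) auto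
  then have "?c \<in> C" using H by (auto simp: C eq)
  moreover have "0\<^sub>v n \<in> C" using H by (auto simp: C)
  ultimately have "min_dist C \<le> hamming_dist ?c (0\<^sub>v n)"
    using ne by (intro min_dist_le)
  also have "\<dots> \<le> card (support n e \<union> support n e')"
    unfolding hamming_dist_def by (intro card_mono) (auto simp: support_def)
  also have "\<dots> \<le> t" using wt card_Un_le le_trans by blast
  finally show False using min by simp
qed

theorem theorem4p2:
  fixes \<alpha> w :: "nat \<Rightarrow> 'a::{field, finite}"
    and f :: "'a poly"
    and t n :: nat
    and H :: "'a mat" and C :: "'a vec set"
    and r :: "'a vec" and S :: "'a poly"
  assumes "inj_on \<alpha> {..<n}"
    and "\<And>i. i < n \<Longrightarrow> \<alpha> i \<noteq> 0"
    and "\<And>i. i < n \<Longrightarrow> w i \<noteq> 0"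
    and "t \<ge> 2" and "even t" and "t < n"
    and "H = parity_check t n \<alpha> w f"
    and "vec_space.rank t H = t"
    and "C = {c \<in> carrier_vec n. H *\<^sub>v c = 0\<^sub>v t}"
    and "mds_code n (n - t) (t + 1) C"
    and "r \<in> carrier_vec n"
    and "dist_to_code r C \<le> t div 2"
    and "S = syndrome_poly t H r"
  shows "\<exists>\<sigma> \<tau>. key_equation_pair t n \<alpha> w f S \<sigma> \<tau> \<and>
           (\<forall>\<sigma>' \<tau>'. key_equation_pair t n \<alpha> w f S \<sigma>' \<tau>' \<longleftrightarrow>
              (\<exists>c. c \<noteq> 0 \<and> \<sigma>' = Polynomial.smult c \<sigma> \<and> \<tau>' = Polynomial.smult c \<tau>))"
proof -
  have t: "t > 0" using assms(4) by simp
  have H: "H \<in> carrier_mat t n" by (simp add: assms(7) parity_check_def)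
  have min: "t < min_dist C" using assms(10) by (simp add: mds_code_def linear_code_def)
  \<comment> \<open>A nonempty code is what makes the distance from \<open>r\<close> attained by
    some codeword.\<close>
  have "0\<^sub>v n \<in> C" using H by (auto simp: assms(9))
  then obtain c where c: "c \<in> C" "hamming_dist r c \<le> t div 2"
    using dist_to_code_attained[of C r] assms(12) by (metis empty_iff)
  have cn: "c \<in> carrier_vec n" "H *\<^sub>v c = 0\<^sub>v t" using c(1) by (auto simp: assms(9))
  \<comment> \<open>The error relative to a nearest codeword: it has the syndrome of
    \<open>r\<close> and weight at most t/2.\<close>
  define e where "e i = r $ i - c $ i" for i
  have "vec n e = r - c" using assms(11) cn by (intro eq_vecI) (auto simp: e_def)
  then have "H *\<^sub>v vec n e = H *\<^sub>v r - H *\<^sub>v c"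
    using H assms(11) cn by (simp add: mult_minus_distrib_mat_vec)
  also have "\<dots> = H *\<^sub>v r" using H by (intro eq_vecI) (auto simp: cn)
  finally have He: "S = syndrome_poly t H (vec n e)"
    using H by (simp add: assms(13) syndrome_poly_eq_iff)
  have wt: "card (support n e) \<le> t div 2"
    using c(2) assms(11) by (simp add: support_def e_def hamming_dist_def)
  obtain \<sigma> where loc: "locates n \<alpha> e \<sigma>" by (rule locates_exists)
  let ?\<tau> = "numerator t n \<alpha> w f e"
  \<comment> \<open>Stated for every locator of \<open>e\<close>, because the scalar multiples of
    \<sigma> are to be covered as well.\<close>
  have pair: "key_equation_pair t n \<alpha> w f S \<sigma>' (?\<tau> \<sigma>')" if "locates n \<alpha> e \<sigma>'" for \<sigma>'
    using key_equation_pair_of_error[OF assms(1-3) t that wt] by (simp add: He assms(7))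
  have uniq: "\<exists>c. c \<noteq> 0 \<and> \<sigma>' = Polynomial.smult c \<sigma> \<and> \<tau>' = Polynomial.smult c (?\<tau> \<sigma>)"
    if \<sigma>'\<tau>': "key_equation_pair t n \<alpha> w f S \<sigma>' \<tau>'" for \<sigma>' \<tau>'
  proof -
    obtain e' where e': "locates n \<alpha> e' \<sigma>'" "card (support n e') \<le> t div 2"
      "\<tau>' = numerator t n \<alpha> w f e' \<sigma>'" "syndrome_poly t H (vec n e') = S"
      using error_of_key_equation_pair[of \<alpha> n w t f H r \<sigma>' \<tau>'] assms(1-3) t \<sigma>'\<tau>'
      unfolding assms(7,13) by blast
    \<comment> \<open>Both weights are at most \<open>t div 2\<close>, so together they stay within
      \<open>t\<close>.\<close>
    have "vec n e = vec n e'"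
    proof (rule vec_eq_if_same_syndrome[OF H assms(9) min])
      show "H *\<^sub>v vec n e = H *\<^sub>v vec n e'"
        using e'(4) H by (simp add: He syndrome_poly_eq_iff)
    qed (use wt e'(2) in linarith)
    then have ee: "e i = e' i" if "i < n" for i using that by (metis index_vec)
    then have supp: "support n e' = support n e" by (auto simp: support_def)
    \<comment> \<open>The functions \<open>e\<close> and \<open>e'\<close> agree only below
      \<open>n\<close>, but the numerator consults them on the support alone.\<close>
    have \<tau>': "\<tau>' = ?\<tau> \<sigma>'"
      unfolding e'(3) numerator_def evaluator_def supp
      by (intro arg_cong2[where f = "(+)"] arg_cong[where f = uminus] sum.cong
          arg_cong2[where f = Polynomial.smult]) (auto simp: ee support_def)
    have "inj_on \<alpha> (support n e)"
      using assms(1) by (rule inj_on_subset) (auto simp: support_def)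
    then obtain c where "c \<noteq> 0" "\<sigma>' = Polynomial.smult c \<sigma>"
      using e'(1) loc eq_smult_if_common_roots[of \<sigma>' \<sigma> "support n e" \<alpha>]
      unfolding locates_def supp by blast
    then show ?thesis using \<tau>' by (auto simp: numerator_smult)
  qed
  show ?thesis
  proof (rule exI[of _ \<sigma>], rule exI[of _ "?\<tau> \<sigma>"], intro conjI allI iffI)
    show "key_equation_pair t n \<alpha> w f S \<sigma> (?\<tau> \<sigma>)" using loc by (rule pair)
  next
    fix \<sigma>' \<tau>' assume "\<exists>c. c \<noteq> 0 \<and> \<sigma>' = Polynomial.smult c \<sigma> \<and> \<tau>' = Polynomial.smult c (?\<tau> \<sigma>)"
    \<comment> \<open>A nonzero multiple of \<sigma> locates the same error, and the numerator
      scales along with it.\<close>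
    then show "key_equation_pair t n \<alpha> w f S \<sigma>' \<tau>'"
      using pair locates_smult[OF loc] by (auto simp flip: numerator_smult)
  next
    fix \<sigma>' \<tau>' assume "key_equation_pair t n \<alpha> w f S \<sigma>' \<tau>'"
    then show "\<exists>c. c \<noteq> 0 \<and> \<sigma>' = Polynomial.smult c \<sigma> \<and> \<tau>' = Polynomial.smult c (?\<tau> \<sigma>)"
      by (rule uniq)
  qed
qed

end
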